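(* Let $X_1, X_2, \dots, X_n$ be $n$ independent real random variables with $\mathbb{E}[X_i] = 0$ and $X_i \ge -1$ for each $i$, and let $X = \sum_{i=1}^n X_i$. Then $$\text{Prob}[X \le 1] \ge 0.1536.$$
   Context: $\text{Prob}$ denotes probability and $\mathbb{E}$ denotes expectation. The number $n$ of random variables is an arbitrary positive integer, and the random variables are not assumed to be identically distributed. *)

theory Defs
  imports "HOL-Probability.Probability"
begin

end

(* The proof gives the constant 5/32 = 0.15625.

   A supporting line shows that a bounded functional of a centred variable with values in [-1, \<infinity>)
   is minimised by a two-point variable, so each X_i may be taken to be -a_i with probability
   b_i / (a_i + b_i) and b_i otherwise, where 0 < a_i \<le> 1.

   Sort by b_i and condition on the variables with b_i \<ge> t taking their lower value.  This costs a
   factor of at least exp (-A / t), where A is the sum of their a_i, and leaves the event S \<le> 1 + A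
   for the remaining sum S.  Take the last cut for which the variance of S dominates the square of
   the largest remaining b_i, and let t be the standard deviation of S.  If 1 + A \<le> 4t/5, a quartic
   test function works; its expectation is controlled because the jumps of S are bounded by t
   upwards and by 1 downwards.  Otherwise, for a later cut at some t' with A \<le> 4t'/5 \<le> 1 + A, the
   variance of S is at most t'^2 and Cantelli's inequality suffices. *)

theory Submission
  imports Defs
begin

section \<open>Sums of two-point variables and their cumulants\<close>

text \<open>The expectation of \<open>h S\<close>, where \<open>S\<close> is a sum of independent centred variables, one for each pair
  \<open>(a, b)\<close>, with values in \<open>{- a, b}\<close>.\<close>

fun two_point :: "(real \<times> real) list \<Rightarrow> (real \<Rightarrow> real) \<Rightarrow> real" where
  "two_point [] h = h 0"
| "two_point ((a, b) # xs) h = (b * two_point xs (\<lambda>s. h (s - a)) + a * two_point xs (\<lambda>s. h (s + b))) / (a + b)"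

definition admissible :: "real \<Rightarrow> (real \<times> real) list \<Rightarrow> bool" where
  "admissible r xs \<longleftrightarrow> (\<forall>(a, b)\<in>set xs. 0 < a \<and> a \<le> r \<and> 0 < b)"

lemma admissible_Nil [simp]: "admissible r []"
  and admissible_Cons [simp]: "admissible r ((a, b) # xs) \<longleftrightarrow> 0 < a \<and> a \<le> r \<and> 0 < b \<and> admissible r xs"
  and admissible_append [simp]: "admissible r (xs @ ys) \<longleftrightarrow> admissible r xs \<and> admissible r ys"
  by (auto simp: admissible_def)

definition total_down :: "(real \<times> real) list \<Rightarrow> real" where
  "total_down xs = (\<Sum>(a, b)\<leftarrow>xs. a)"

definition total_var :: "(real \<times> real) list \<Rightarrow> real" where
  "total_var xs = (\<Sum>(a, b)\<leftarrow>xs. a * b)"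

text \<open>The third cumulant of the sum; for one centred two-point variable it is the third
  moment.\<close>

definition total_cum3 :: "(real \<times> real) list \<Rightarrow> real" where
  "total_cum3 xs = (\<Sum>(a, b)\<leftarrow>xs. a * b * (b - a))"

text \<open>The fourth cumulant of the sum: each term is the fourth moment
  \<open>a * b * (a^2 - a * b + b^2)\<close> minus three times the squared variance. Unlike the
  moment, it adds up over independent summands.\<close>

definition total_cum4 :: "(real \<times> real) list \<Rightarrow> real" where
  "total_cum4 xs = (\<Sum>(a, b)\<leftarrow>xs. a * b * (a\<^sup>2 - 4 * a * b + b\<^sup>2))"

lemma totals_Nil [simp]: "total_down [] = 0" "total_var [] = 0" "total_cum3 [] = 0" "total_cum4 [] = 0"
  by (simp_all add: total_down_def total_var_def total_cum3_def total_cum4_def)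

lemma totals_Cons [simp]:
  "total_down ((a, b) # xs) = a + total_down xs"
  "total_var ((a, b) # xs) = a * b + total_var xs"
  "total_cum3 ((a, b) # xs) = a * b * (b - a) + total_cum3 xs"
  "total_cum4 ((a, b) # xs) = a * b * (a\<^sup>2 - 4 * a * b + b\<^sup>2) + total_cum4 xs"
  by (simp_all add: total_down_def total_var_def total_cum3_def total_cum4_def)

lemma total_var_nonneg: "admissible r xs \<Longrightarrow> total_var xs \<ge> 0"
  by (induction xs) auto

lemma total_down_nonneg: "admissible r xs \<Longrightarrow> total_down xs \<ge> 0"
  by (induction xs) auto

section \<open>Linearity, monotonicity, order independence and scaling\<close>

lemma two_point_linear: "two_point xs (\<lambda>s. c * f s + d * g s) = c * two_point xs f + d * two_point xs g"
proof (induction xs arbitrary: f g)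
  case (Cons x xs)
  obtain a b where [simp]: "x = (a, b)" by (cases x)
  show ?case by (simp add: Cons.IH algebra_simps add_divide_distrib)
qed simp

lemma two_point_mono:
  assumes "admissible r xs" "\<And>s. f s \<le> g s"
  shows "two_point xs f \<le> two_point xs g"
  using assms
proof (induction xs arbitrary: f g)
  case (Cons x xs)
  obtain a b where [simp]: "x = (a, b)" by (cases x)
  from Cons.prems have "0 < a" "0 < b" by auto
  then show ?case using Cons.prems
    by (auto intro!: divide_right_mono add_mono mult_left_mono Cons.IH)
qed simp

lemma two_point_swap: "two_point (x # y # xs) h = two_point (y # x # xs) h"
proof -
  obtain a b c d where [simp]: "x = (a, b)" "y = (c, d)" by (metis surj_pair)
  have *: "(\<lambda>s. h (s - c - a)) = (\<lambda>s. h (s - a - c))" "(\<lambda>s. h (s + d - a)) = (\<lambda>s. h (s - a + d))"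
    "(\<lambda>s. h (s - c + b)) = (\<lambda>s. h (s + b - c))" "(\<lambda>s. h (s + d + b)) = (\<lambda>s. h (s + b + d))"
    by (simp_all add: algebra_simps)
  show ?thesis
    by (simp only: \<open>x = (a, b)\<close> \<open>y = (c, d)\<close> two_point.simps *)
       (simp add: distrib_left add_divide_distrib mult.commute mult.left_commute)
qed

lemma two_point_Cons_cong: "(\<And>h. two_point xs h = two_point ys h) \<Longrightarrow> two_point (x # xs) h = two_point (x # ys) h"
  by (cases x) simp

lemma two_point_middle: "two_point (ys @ x # zs) h = two_point (x # ys @ zs) h"
proof (induction ys arbitrary: h)
  case (Cons y ys)
  have "two_point (y # (ys @ x # zs)) h = two_point (y # (x # ys @ zs)) h"
    by (rule two_point_Cons_cong) (rule Cons.IH)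
  then show ?case by (simp only: append_Cons two_point_swap)
qed simp

text \<open>Allows the summands to be sorted by \<open>b\<close>; it comes down to exchanging
  neighbours.\<close>

lemma two_point_mset: "mset xs = mset ys \<Longrightarrow> two_point xs h = two_point ys h"
proof (induction xs arbitrary: ys h)
  case (Cons x xs)
  then have "x \<in> set ys" by (metis list.set_intros(1) mset_eq_setD)
  then obtain us vs where ys: "ys = us @ x # vs" by (meson split_list)
  with Cons.prems have "mset xs = mset (us @ vs)" by simp
  then have "two_point (x # xs) h = two_point (x # us @ vs) h"
    by (intro two_point_Cons_cong Cons.IH)
  then show ?case by (simp only: ys two_point_middle)
qed simp

lemma two_point_scale: "two_point (map (\<lambda>(a, b). (c * a, c * b)) xs) h = two_point xs (\<lambda>s. h (c * s))" if "c > 0"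
proof (induction xs arbitrary: h)
  case (Cons x xs)
  obtain a b where [simp]: "x = (a, b)" by (cases x)
  have "(c * b * p + c * a * q) / (c * a + c * b) = (b * p + a * q) / (a + b)" for p q
    using that by (metis (no_types, lifting) distrib_left less_irrefl mult.assoc mult_divide_mult_cancel_left)
  then show ?case by (simp add: Cons.IH right_diff_distrib distrib_left)
qed simp

section \<open>Moments, Cantelli's inequality and the cost of conditioning\<close>

text \<open>The mean is 0 and the fourth moment is three times the squared variance plus the fourth
  cumulant. The coefficients vary in the induction because shifting a quartic by a value of the
  first variable gives another quartic.\<close>

lemma two_point_quartic:
  assumes "admissible r xs"
  shows "two_point xs (\<lambda>s. c0 + c1 * s + c2 * s^2 + c3 * s^3 + c4 * s^4)
    = c0 + c2 * total_var xs + c3 * total_cum3 xs + c4 * (3 * (total_var xs)\<^sup>2 + total_cum4 xs)"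
  using assms
proof (induction xs arbitrary: c0 c1 c2 c3 c4)
  case (Cons x xs)
  obtain a b where [simp]: "x = (a, b)" by (cases x)
  from Cons.prems have ab: "0 < a" "0 < b" and st: "admissible r xs" by auto
  have shift: "two_point xs (\<lambda>s. c0 + c1 * (s + w) + c2 * (s + w)^2 + c3 * (s + w)^3 + c4 * (s + w)^4) =
    (c0 + c1 * w + c2 * w^2 + c3 * w^3 + c4 * w^4) + (c2 + 3 * c3 * w + 6 * c4 * w^2) * total_var xs
      + (c3 + 4 * c4 * w) * total_cum3 xs + c4 * (3 * (total_var xs)\<^sup>2 + total_cum4 xs)" (is "two_point xs ?f = _") for w
  proof -
    have "?f = (\<lambda>s. (c0 + c1 * w + c2 * w^2 + c3 * w^3 + c4 * w^4)
       + (c1 + 2 * c2 * w + 3 * c3 * w^2 + 4 * c4 * w^3) * s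
       + (c2 + 3 * c3 * w + 6 * c4 * w^2) * s^2 + (c3 + 4 * c4 * w) * s^3 + c4 * s^4)"
      by (rule ext) algebra
    then show ?thesis by (simp only: Cons.IH[OF st])
  qed
  have identity: "b * ((c0 + c1 * - a + c2 * (- a)^2 + c3 * (- a)^3 + c4 * (- a)^4)
      + (c2 + 3 * c3 * - a + 6 * c4 * (- a)^2) * V + (c3 + 4 * c4 * - a) * K + c4 * (3 * V\<^sup>2 + L))
    + a * ((c0 + c1 * b + c2 * b^2 + c3 * b^3 + c4 * b^4)
      + (c2 + 3 * c3 * b + 6 * c4 * b^2) * V + (c3 + 4 * c4 * b) * K + c4 * (3 * V\<^sup>2 + L))
    = (c0 + c2 * (a * b + V) + c3 * (a * b * (b - a) + K)
      + c4 * (3 * (a * b + V)\<^sup>2 + (a * b * (a\<^sup>2 - 4 * a * b + b\<^sup>2) + L))) * (a + b)"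
    for V K L :: real by algebra
  show ?case
    using shift[of b] shift[of "- a"] ab
    by (simp only: \<open>x = (a, b)\<close> two_point.simps totals_Cons diff_conv_add_uminus identity) simp
qed simp

lemma two_point_cantelli:
  assumes "admissible r xs" "B > 0"
  shows "two_point xs (indicator {..B}) \<ge> B\<^sup>2 / (B\<^sup>2 + total_var xs)"
proof -
  define V where "V = total_var xs"
  define D where "D = B\<^sup>2 + V"
  have D: "D > 0" using total_var_nonneg[OF assms(1)] assms(2) by (simp add: D_def V_def add_pos_nonneg)
  \<comment> \<open>the parabola that is at most 1 and vanishes at \<open>B\<close>, with its maximum at \<open>- V / B\<close>\<close>
  let ?f = "\<lambda>s. (1 - V\<^sup>2 / D\<^sup>2) + (- 2 * B * V / D\<^sup>2) * s + (- B\<^sup>2 / D\<^sup>2) * s^2 + 0 * s^3 + 0 * s^4"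
  have f: "?f s = 1 - ((B * s + V) / D)\<^sup>2" for s
    using D by (simp add: field_simps power2_eq_square)
  have "?f s \<le> indicator {..B} s" for s
  proof (cases "s \<le> B")
    case False
    then have "B * s \<ge> B\<^sup>2" using assms(2) by (simp add: power2_eq_square)
    then have "(B * s + V) / D \<ge> 1" using D by (simp add: D_def)
    then have "((B * s + V) / D)\<^sup>2 \<ge> 1" by (rule one_le_power)
    with False show ?thesis unfolding f by simp
  qed (simp only: f, simp)
  then have "two_point xs ?f \<le> two_point xs (indicator {..B})"
    by (rule two_point_mono[OF assms(1)])
  moreover have "two_point xs ?f = B\<^sup>2 / D"
  proof -
    have "two_point xs ?f = 1 - (V\<^sup>2 + B\<^sup>2 * V) / D\<^sup>2"
      unfolding two_point_quartic[OF assms(1)] by (simp add: V_def add_divide_distrib)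
    also have "V\<^sup>2 + B\<^sup>2 * V = V * D" by (simp add: D_def power2_eq_square algebra_simps)
    also have "1 - V * D / D\<^sup>2 = (D - V) / D" using D by (simp add: field_simps power2_eq_square)
    finally show ?thesis by (simp add: D_def)
  qed
  ultimately show ?thesis by (simp add: D_def V_def)
qed

text \<open>Only the event that all of \<open>xs\<close> take their lower values is kept. Each does
  so with probability \<open>b / (a + b)\<close>, the inverse of
  \<open>1 + a / b \<le> exp (a / b) \<le> exp (a / t)\<close>.\<close>

lemma two_point_drop:
  assumes "admissible r (xs @ ys)" "t > 0" "\<And>a b. (a, b) \<in> set xs \<Longrightarrow> t \<le> b" "\<And>s. h s \<ge> 0"
  shows "two_point (xs @ ys) h \<ge> exp (- total_down xs / t) * two_point ys (\<lambda>s. h (s - total_down xs))"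
  using assms
proof (induction xs arbitrary: h)
  case (Cons x xs)
  obtain a b where x [simp]: "x = (a, b)" by (cases x)
  from Cons.prems have ab: "0 < a" "0 < b" "t \<le> b" and st: "admissible r (xs @ ys)" "admissible r ys" by auto
  have nn: "two_point zs g \<ge> 0" if "admissible r zs" "\<And>s. g s \<ge> 0" for zs g
  proof -
    have "two_point zs (\<lambda>s. 0) \<le> two_point zs g" by (rule two_point_mono[OF that])
    moreover have "two_point zs (\<lambda>s. 0) = 0" using two_point_linear[of zs 0 "\<lambda>_. 0" 0 "\<lambda>_. 0"] by simp
    ultimately show ?thesis by simp
  qed
  have "exp (- a / t) \<le> b / (a + b)"
  proof -
    have "(a + b) / b = 1 + a / b" using ab by (simp add: field_simps)
    also have "\<dots> \<le> exp (a / b)" by (rule exp_ge_add_one_self)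
    also have "\<dots> \<le> exp (a / t)" using ab \<open>t > 0\<close> by (simp add: frac_le)
    finally have "inverse (exp (a / t)) \<le> inverse ((a + b) / b)"
      using ab by (intro le_imp_inverse_le) auto
    then show ?thesis by (simp add: exp_minus)
  qed
  moreover have "exp (- total_down xs / t) * two_point ys (\<lambda>s. h (s - total_down xs - a)) \<le> two_point (xs @ ys) (\<lambda>s. h (s - a))"
    using Cons.prems by (intro Cons.IH) auto
  moreover have "0 \<le> exp (- total_down xs / t) * two_point ys (\<lambda>s. h (s - total_down xs - a))"
    using nn[OF st(2)] Cons.prems(4) by simp
  ultimately have "exp (- a / t) * (exp (- total_down xs / t) * two_point ys (\<lambda>s. h (s - total_down xs - a)))
     \<le> b / (a + b) * two_point (xs @ ys) (\<lambda>s. h (s - a))"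
    using ab by (intro mult_mono) auto
  also have "\<dots> \<le> b / (a + b) * two_point (xs @ ys) (\<lambda>s. h (s - a)) + a / (a + b) * two_point (xs @ ys) (\<lambda>s. h (s + b))"
    using nn[OF st(1), of "\<lambda>s. h (s + b)"] Cons.prems(4) ab by simp
  also have "\<dots> = two_point ((x # xs) @ ys) h" by (simp add: add_divide_distrib)
  finally show ?case
    by (simp add: exp_add[symmetric] mult.assoc[symmetric] add_divide_distrib diff_divide_distrib algebra_simps)
qed simp

section \<open>The quartic bound for large variance\<close>

text \<open>The case of unit variance, with jumps at most 1 upwards and \<open>r\<close> downwards.
  The factor \<open>exp (p - r)\<close> is there to pay for the variables dropped earlier.\<close>

lemma two_point_quartic_test:
  assumes st: "admissible r xs" and le1: "\<And>a b. (a, b) \<in> set xs \<Longrightarrow> b \<le> 1"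
    and var: "total_var xs = 1" and rp: "0 \<le> r" "r \<le> p" "p \<le> 4/5"
  shows "two_point xs (indicator {..p}) \<ge> 5/32 * exp (p - r)"
proof -
  define e where "e = 2 - p"
  \<comment> \<open>The expanded form of \<open>(1 - y/4)\<^sup>2 (1 - y/2) (1 + y)\<close> with \<open>y = s + e\<close>. It is at most 1 with a
    double contact at \<open>y = 0\<close>, changes sign at \<open>y = 2\<close>, i.e. at \<open>s = p\<close>, and has a double zero beyond.\<close>
  let ?g = "\<lambda>s. (1 - 11/16 * e^2 + 9/32 * e^3 - 1/32 * e^4)
     + (- 11/8 * e + 27/32 * e^2 - 1/8 * e^3) * s
     + (- 11/16 + 27/32 * e - 3/16 * e^2) * s^2 + (9/32 - 1/8 * e) * s^3 + (- 1/32) * s^4"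
  have g1: "?g s = (1 - (s + e) / 4)\<^sup>2 * (1 - (s + e) / 2) * (1 + (s + e))" for s
    by (simp add: field_simps) algebra
  have g2: "?g s = 1 - (s + e)\<^sup>2 / 32 * ((s + e - 9/2)\<^sup>2 + 7/4)" for s
    by (simp add: field_simps) algebra
  have "?g s \<le> indicator {..p} s" for s
  proof (cases "s \<le> p")
    case True
    then show ?thesis unfolding g2 by simp
  next
    case False
    then have "1 - (s + e) / 2 \<le> 0" "0 \<le> 1 + (s + e)" by (auto simp: e_def)
    then have "(1 - (s + e) / 4)\<^sup>2 * (1 - (s + e) / 2) * (1 + (s + e)) \<le> 0"
      by (intro mult_nonpos_nonneg mult_nonneg_nonpos) auto
    with False show ?thesis unfolding g1 by simp
  qed
  then have "two_point xs ?g \<le> two_point xs (indicator {..p})"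
    by (rule two_point_mono[OF st])
  \<comment> \<open>This combination is the cumulant part of 32 times the expectation of
    \<open>?g\<close>, since \<open>9 - 4 * e = 1 + 4 * p\<close>. It is bounded summand by summand;
    after division by \<open>a * b\<close> the slack is a sum of nonnegative terms.\<close>
  moreover have "(1 + 4 * p) * total_cum3 xs - total_cum4 xs \<ge> - (r * (1 + 4 * p + r)) * total_var xs"
    using st le1
  proof (induction xs)
    case (Cons x xs)
    obtain a b where [simp]: "x = (a, b)" by (cases x)
    from Cons.prems have ab: "0 < a" "a \<le> r" "0 < b" "b \<le> 1" by auto
    have "0 \<le> (r - a) * (1 + 4 * p) + (r\<^sup>2 - a\<^sup>2) + b * (1 - b) + 4 * p * b + 4 * a * b"
      using ab rp by (intro add_nonneg_nonneg mult_nonneg_nonneg) (auto intro!: power_mono)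
    then have "0 \<le> (a * b) * ((r - a) * (1 + 4 * p) + (r\<^sup>2 - a\<^sup>2) + b * (1 - b) + 4 * p * b + 4 * a * b)"
      using ab by (intro mult_nonneg_nonneg) auto
    then have "0 \<le> (1 + 4 * p) * (a * b * (b - a)) - a * b * (a\<^sup>2 - 4 * a * b + b\<^sup>2) + (r * (1 + 4 * p + r)) * (a * b)"
      by (rule order_trans) (rule eq_refl, algebra)
    moreover have "- (r * (1 + 4 * p + r)) * total_var xs \<le> (1 + 4 * p) * total_cum3 xs - total_cum4 xs"
      using Cons.prems by (intro Cons.IH) auto
    ultimately show ?case
      unfolding \<open>x = (a, b)\<close> totals_Cons by (simp only: distrib_left minus_mult_left[symmetric])
  qed simp
  moreover have "32 * two_point xs ?g = 5 + 9 * p + 2 * p^2 - p^3 - p^4 + ((1 + 4 * p) * total_cum3 xs - total_cum4 xs)"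
    unfolding two_point_quartic[OF st] var e_def by (simp add: field_simps) algebra
  \<comment> \<open>Equality holds at \<open>p = r = 0\<close>, which is where \<open>5/32\<close>
    comes from. Otherwise \<open>exp x \<le> 1 + x + x^2\<close> on [0, 1] is used for
    \<open>x = p - r\<close>, and \<open>p \<le> 4/5\<close> makes the higher powers of
    \<open>p\<close> linear.\<close>
  moreover have "5 + 9 * p + 2 * p^2 - p^3 - p^4 - r * (1 + 4 * p + r) \<ge> 5 * exp (p - r)"
  proof -
    have "p^2 \<le> 4/5 * p" using rp mult_right_mono[of p "4/5" p] by (simp add: power2_eq_square)
    moreover have "p^3 \<le> 16/25 * p" 
      using rp mult_right_mono[OF power_mono[of p "4/5" 2], of p] by (simp add: power2_eq_square power3_eq_cube)
    moreover have "p^4 \<le> 64/125 * p"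
      using rp mult_right_mono[OF power_mono[of p "4/5" 3], of p] by (simp add: power3_eq_cube power4_eq_xxxx)
    moreover have "0 \<le> 6 * (p * r - r * r)" using rp by (simp add: mult_right_mono)
    ultimately have "0 \<le> 4 * p + 4 * r - 3 * p^2 + 6 * (p * r - r * r) - p^3 - p^4"
      using rp by linarith
    also have "\<dots> = (5 + 9 * p + 2 * p^2 - p^3 - p^4 - r * (1 + 4 * p + r)) - 5 * (1 + (p - r) + (p - r)\<^sup>2)"
      by algebra
    finally show ?thesis using exp_bound[of "p - r"] rp by simp
  qed
  ultimately show ?thesis using var by simp
qed

text \<open>Division by the standard deviation \<open>t\<close> reduces this to unit variance with
  \<open>r = 1/t\<close> and \<open>p = B/t\<close>. For \<open>B = 1 + A\<close> the gain is
  \<open>exp (A / t)\<close>, exactly the cost of dropping.\<close>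

lemma two_point_quartic_scaled:
  assumes st: "admissible 1 xs" and le: "\<And>a b. (a, b) \<in> set xs \<Longrightarrow> b \<le> t"
    and var: "total_var xs = t\<^sup>2" and t: "0 < t" and B: "1 \<le> B" "B \<le> 4/5 * t"
  shows "two_point xs (indicator {..B}) \<ge> 5/32 * exp ((B - 1) / t)"
proof -
  define ys where "ys = map (\<lambda>(a, b). (1/t * a, 1/t * b)) xs"
  have "total_var ys = (1/t)\<^sup>2 * total_var xs"
    unfolding ys_def using t by (induction xs) (auto simp: power2_eq_square field_simps)
  then have "total_var ys = 1" using t var by (simp add: power_divide)
  moreover have "admissible (1/t) ys"
    using st t unfolding ys_def by (auto simp: admissible_def divide_right_mono)
  moreover have "b \<le> 1" if "(a, b) \<in> set ys" for a b
    using that le t by (auto simp: ys_def)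
  ultimately have "5/32 * exp (B / t - 1 / t) \<le> two_point ys (indicator {..B / t})"
    using t B by (intro two_point_quartic_test) (auto simp: divide_simps)
  also have "\<dots> = two_point xs (\<lambda>s. indicator {..B / t} (1/t * s))"
    unfolding ys_def using t by (intro two_point_scale) simp
  also have "(\<lambda>s. indicator {..B / t} (1/t * s) :: real) = indicator {..B}"
    using t by (auto simp: indicator_def fun_eq_iff divide_simps)
  finally show ?thesis by (simp add: diff_divide_distrib)
qed

section \<open>Choice of the cut and the bound for two-point sums\<close>

text \<open>Dropped variables at their lower values raise the threshold from 1 to
  \<open>1 + A\<close>; the factor \<open>exp (A / t)\<close> in the last hypothesis cancels the
  loss in \<open>two_point_drop\<close>.\<close>

lemma two_point_drop_indicator:
  assumes "admissible 1 xs" "m \<le> length xs" "t > 0" "\<And>i. i < m \<Longrightarrow> t \<le> snd (xs ! i)"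
    and "two_point (drop m xs) (indicator {..1 + total_down (take m xs)}) \<ge> q * exp (total_down (take m xs) / t)"
  shows "two_point xs (indicator {..1}) \<ge> q"
proof -
  let ?A = "total_down (take m xs)"
  have "q = exp (- ?A / t) * (q * exp (?A / t))" by (simp add: exp_minus)
  also have "\<dots> \<le> exp (- ?A / t) * two_point (drop m xs) (indicator {..1 + ?A})"
    using assms by (intro mult_left_mono) auto
  also have "indicator {..1 + ?A} = (\<lambda>s. indicator {..1} (s - ?A) :: real)"
    by (auto simp: indicator_def fun_eq_iff)
  also have "exp (- ?A / t) * two_point (drop m xs) (\<lambda>s. indicator {..1} (s - ?A)) \<le> two_point (take m xs @ drop m xs) (indicator {..1})"
    using assms by (intro two_point_drop[of 1]) (fastforce simp: in_set_conv_nth)+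
  finally show ?thesis by simp
qed

text \<open>The cut is moved towards larger \<open>b\<close> until \<open>A \<le> 4/5 * t\<close>. As each step lowers \<open>A\<close> by at most 1,
  it cannot skip the window \<open>A \<le> 4/5 * t \<le> 1 + A\<close>.\<close>

lemma exists_threshold:
  assumes st: "admissible 1 xs" and desc: "sorted_wrt (\<lambda>x y. snd y \<le> snd x) xs"
    and "j \<le> length xs" and "0 \<le> u" "total_var (drop j xs) \<le> u\<^sup>2" "4/5 * u < 1 + total_down (take j xs)"
    and "\<And>i. i < j \<Longrightarrow> u \<le> snd (xs ! i)"
    and "\<And>i. i < j \<Longrightarrow> total_var (drop i xs) \<le> (snd (xs ! i))\<^sup>2"
  shows "\<exists>m t. m \<le> length xs \<and> 0 < t \<and> (\<forall>i<m. t \<le> snd (xs ! i)) \<and> total_var (drop m xs) \<le> t\<^sup>2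
    \<and> total_down (take m xs) \<le> 4/5 * t \<and> 4/5 * t \<le> 1 + total_down (take m xs)"
  using assms(3-)
proof (induction j arbitrary: u)
  case 0
  then have "u\<^sup>2 \<le> (5/4)\<^sup>2" by (intro power_mono) auto
  with 0 have "total_var (drop 0 xs) \<le> (5/4)\<^sup>2" by linarith
  \<comment> \<open>With nothing dropped, \<open>t = 5/4\<close> gives \<open>4/5 * t = 1\<close>,
    the upper end of the window.\<close>
  then show ?case by (intro exI[of _ 0] exI[of _ "5/4"]) simp
next
  case (Suc j)
  let ?A = "total_down (take (Suc j) xs)" and ?b = "snd (xs ! j)"
  have in_set: "xs ! j \<in> set xs" using Suc.prems by simp
  then have b: "0 < ?b" "fst (xs ! j) \<le> 1" using st by (auto simp: admissible_def case_prod_beta)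
  have A: "?A = total_down (take j xs) + fst (xs ! j)"
    using Suc.prems by (simp add: take_Suc_conv_app_nth total_down_def case_prod_beta)
  show ?case
  proof (cases "?A \<le> 4/5 * ?b")
    case True
    \<comment> \<open>The largest \<open>t\<close> with \<open>t \<le> ?b\<close> and
      \<open>4/5 * t \<le> 1 + ?A\<close>. It is at least \<open>u\<close>, so the variance bound
      survives.\<close>
    define t where "t = min ?b (5/4 * (1 + ?A))"
    have "u \<le> t" using Suc.prems by (auto simp: t_def)
    have "0 < 1 + ?A" using Suc.prems by linarith
    then have "0 < t" using b by (simp add: t_def)
    moreover have "total_var (drop (Suc j) xs) \<le> t\<^sup>2"
      using Suc.prems(2,3) power_mono[OF \<open>u \<le> t\<close>, of 2] by linarith
    moreover have "t \<le> snd (xs ! i)" if "i < Suc j" for i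
      using that sorted_wrt_nth_less[OF desc, of i j] Suc.prems
      by (cases "i = j") (auto simp: t_def min_le_iff_disj)
    moreover have "?A \<le> 4/5 * t" "4/5 * t \<le> 1 + ?A"
      using True by (auto simp: t_def min_def)
    ultimately show ?thesis using Suc.prems by blast
  next
    case False
    show ?thesis
    proof (rule Suc.IH[of ?b])
      \<comment> \<open>As \<open>fst (xs ! j) \<le> 1\<close>, giving back variable
        \<open>j\<close> lowers \<open>?A\<close> by at most 1, so the invariant holds again with
        \<open>?b\<close> in place of \<open>u\<close>.\<close>
      show "4/5 * ?b < 1 + total_down (take j xs)" using False A b by linarith
      show "?b \<le> snd (xs ! i)" if "i < j" for i
        using that sorted_wrt_nth_less[OF desc, of i j] Suc.prems by auto
    qed (use Suc.prems b in auto)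
  qed
qed

lemma two_point_ge:
  assumes "admissible 1 xs"
  shows "two_point xs (indicator {..1}) \<ge> 5/32"
proof -
  have main: "two_point xs (indicator {..1}) \<ge> 5/32"
    if st: "admissible 1 xs" and desc: "sorted_wrt (\<lambda>x y. snd y \<le> snd x) xs" for xs
  proof -
    \<comment> \<open>The alternative \<open>m = length xs\<close> guarantees a least index. Every
      earlier index fails the test, which bounds the remaining variance there by the square of its
      \<open>b\<close>.\<close>
    define P where "P m \<longleftrightarrow> m = length xs \<or> m < length xs \<and> (snd (xs ! m))\<^sup>2 \<le> total_var (drop m xs)" for m
    define m where "m = (LEAST m. P m)"
    have "P (length xs)" by (simp add: P_def)
    then have "P m" unfolding m_def by (rule LeastI)
    then have m: "m \<le> length xs" by (auto simp: P_def)
    have before: "total_var (drop i xs) < (snd (xs ! i))\<^sup>2" if "i < m" for i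
      using not_less_Least[of i P, folded m_def, OF that] that m by (auto simp: P_def)
    have std: "admissible 1 (drop i xs)" for i using st by (auto simp: admissible_def dest: in_set_dropD)
    have pos: "0 < snd (xs ! i)" if "i < length xs" for i
      using st that nth_mem[OF that] by (auto simp: admissible_def case_prod_beta)
    have "admissible 1 (take i xs)" for i using st by (auto simp: admissible_def dest: in_set_takeD)
    then have A: "0 \<le> total_down (take i xs)" for i by (rule total_down_nonneg)
    have var_mono: "total_var (drop j xs) \<le> total_var (drop i xs)" if "i \<le> j" for i j
    proof -
      have "drop i xs = take (j - i) (drop i xs) @ drop j xs"
        using that by (metis append_take_drop_id drop_drop le_add_diff_inverse2)
      moreover have "total_var (ys @ zs) = total_var ys + total_var zs" for ys zs by (simp add: total_var_def)
      moreover have "admissible 1 (take (j - i) (drop i xs))"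
        using std[of i] by (auto simp: admissible_def dest: in_set_takeD)
      ultimately show ?thesis using total_var_nonneg by (metis le_add_same_cancel2)
    qed
    \<comment> \<open>This value separates the list: dropped variables have
      \<open>b \<ge> t\<close>, kept ones \<open>b \<le> t\<close>. It may be 0.\<close>
    define t where "t = sqrt (total_var (drop m xs))"
    have t: "t\<^sup>2 = total_var (drop m xs)" "0 \<le> t" using total_var_nonneg[OF std] by (auto simp: t_def)
    have dropped: "t \<le> snd (xs ! i)" if "i < m" for i
    proof -
      have "t\<^sup>2 \<le> (snd (xs ! i))\<^sup>2" using t before[OF that] var_mono[of i m] that by simp
      then show ?thesis using pos[of i] that m by (auto intro: power2_le_imp_le)
    qed
    have kept: "b \<le> t" if ab: "(a, b) \<in> set (drop m xs)" for a b
    proof -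
      from ab obtain i where i: "i < length xs - m" "xs ! (m + i) = (a, b)"
        by (auto simp: in_set_conv_nth)
      then have "b \<le> snd (xs ! m)" using sorted_wrt_nth_less[OF desc, of m "m + i"] by (cases i) auto
      also have "(snd (xs ! m))\<^sup>2 \<le> t\<^sup>2" using \<open>P m\<close> i t by (auto simp: P_def)
      then have "snd (xs ! m) \<le> t" using t(2) by (rule power2_le_imp_le)
      finally show ?thesis .
    qed
    show ?thesis
    proof (cases "1 + total_down (take m xs) \<le> 4/5 * t")
      case True
      then have "t > 0" using A[of m] by linarith
      show ?thesis
        using two_point_quartic_scaled[OF std kept t(1)[symmetric] \<open>t > 0\<close> _ True] A[of m] m dropped st \<open>t > 0\<close>
        by (intro two_point_drop_indicator[of xs m t]) auto
    next
      case False
      obtain k u where k: "k \<le> length xs" "0 < u" "\<And>i. i < k \<Longrightarrow> u \<le> snd (xs ! i)"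
        "total_var (drop k xs) \<le> u\<^sup>2" "total_down (take k xs) \<le> 4/5 * u" "4/5 * u \<le> 1 + total_down (take k xs)"
        using exists_threshold[OF st desc m t(2) _ _ dropped less_imp_le[OF before]] t False by auto
      let ?B = "1 + total_down (take k xs)"
      have "5/32 * exp (total_down (take k xs) / u) \<le> 5/32 * exp (4/5)"
        using k by (simp add: field_simps)
      \<comment> \<open>\<open>16/41 = 1 / (1 + 25/16)\<close> is Cantelli's bound when the variance
        is at most \<open>u^2\<close> and \<open>4/5 * u \<le> ?B\<close>;
        \<open>exp (4/5) \<le> 2.44\<close> leaves room.\<close>
      also have "\<dots> \<le> 16/41"
        using exp_bound[of "4/5"] by (simp add: power2_eq_square)
      also have "\<dots> \<le> ?B\<^sup>2 / (?B\<^sup>2 + total_var (drop k xs))"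
      proof -
        have "(4/5 * u)\<^sup>2 \<le> ?B\<^sup>2" using k by (intro power_mono) auto
        then have "total_var (drop k xs) \<le> 25/16 * ?B\<^sup>2" using k(4) by (simp add: power_mult_distrib power_divide)
        moreover have "0 < ?B\<^sup>2 + total_var (drop k xs)"
          using A[of k] total_var_nonneg[OF std[of k]] by (intro add_pos_nonneg) auto
        ultimately show ?thesis by (simp add: pos_le_divide_eq)
      qed
      also have "\<dots> \<le> two_point (drop k xs) (indicator {..?B})"
        using A[of k] by (intro two_point_cantelli[OF std]) auto
      finally show ?thesis using k st by (intro two_point_drop_indicator[of xs k u]) auto
    qed
  qed
  define ys where "ys = sort_key (\<lambda>x. - snd x) xs"
  have mset: "mset xs = mset ys" by (simp add: ys_def)
  have "sorted (map (\<lambda>x. - snd x) ys)" by (simp add: ys_def)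
  then have "sorted_wrt (\<lambda>x y. snd y \<le> snd x) ys" by (simp add: sorted_map)
  moreover have "admissible 1 ys" using assms by (simp add: admissible_def ys_def)
  ultimately show ?thesis unfolding two_point_mset[OF mset] by (intro main)
qed

section \<open>Reduction to two-point variables\<close>

text \<open>The two-point condition says that seen from the point (0, \<open>m\<close>), no slope to
  the left exceeds a slope to the right. The infimum of the right slopes separates them.\<close>

lemma supporting_line:
  fixes \<phi> :: "real \<Rightarrow> real"
  assumes "m \<le> \<phi> 0"
    and two: "\<And>a b. 0 < a \<Longrightarrow> a \<le> 1 \<Longrightarrow> 0 < b \<Longrightarrow> m \<le> (b * \<phi> (- a) + a * \<phi> b) / (a + b)"
  shows "\<exists>l. \<forall>z\<ge>-1. m + l * z \<le> \<phi> z"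
proof -
  have slopes: "(m - \<phi> (- a)) / a \<le> (\<phi> b - m) / b" if "0 < a" "a \<le> 1" "0 < b" for a b
    using two[OF that] that by (simp add: field_simps)
  define l where "l = (INF b\<in>{0<..}. (\<phi> b - m) / b)"
  have "bdd_below ((\<lambda>b. (\<phi> b - m) / b) ` {0<..})"
    using slopes[of 1] by (intro bdd_belowI2) auto
  then have right: "l \<le> (\<phi> b - m) / b" if "0 < b" for b
    unfolding l_def using that by (intro cINF_lower) auto
  have left: "(m - \<phi> (- a)) / a \<le> l" if "0 < a" "a \<le> 1" for a
    unfolding l_def using slopes[OF that] by (intro cINF_greatest) (auto intro: exI[of _ 1])
  have "m + l * z \<le> \<phi> z" if "z \<ge> -1" for z
  proof (cases z "0 :: real" rule: linorder_cases)
    case less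
    then show ?thesis using left[of "- z"] that by (simp add: field_simps)
  next
    case greater
    then show ?thesis using right[of z] by (simp add: field_simps)
  qed (use assms in simp)
  then show ?thesis by blast
qed

text \<open>One variable is split off at a time, with \<open>h\<close> arbitrary. Averaging over the
  others gives a function of \<open>X i\<close> that lies above a line through (0,
  \<open>m\<close>), and the mean of \<open>X i\<close> is 0.\<close>

lemma (in prob_space) expectation_ge_of_two_point:
  fixes X :: "'b \<Rightarrow> 'a \<Rightarrow> real"
  assumes "finite I" "indep_vars (\<lambda>_. borel) X I"
    and "\<And>i. i \<in> I \<Longrightarrow> integrable M (X i)"
    and "\<And>i. i \<in> I \<Longrightarrow> expectation (X i) = 0"
    and "\<And>i. i \<in> I \<Longrightarrow> AE \<omega> in M. X i \<omega> \<ge> -1"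
    and "h \<in> borel_measurable borel" "\<And>s. \<bar>h s\<bar> \<le> 1"
    and "\<And>xs. admissible 1 xs \<Longrightarrow> m \<le> two_point xs h"
  shows "m \<le> expectation (\<lambda>\<omega>. h (\<Sum>i\<in>I. X i \<omega>))"
  using assms
proof (induction I arbitrary: h rule: finite_induct)
  case empty
  then show ?case using empty(7)[of "[]"] by (simp add: prob_space)
next
  case (insert i I)
  note [measurable] = insert.prems(5)
  define S where "S = (\<lambda>\<omega>. \<Sum>i\<in>I. X i \<omega>)"
  have indep: "indep_var borel (X i) borel S"
    unfolding S_def using insert by (intro indep_vars_sum) auto
  have [measurable]: "random_variable borel (X i)" "random_variable borel S"
    using indep by (rule indep_var_rv1, rule indep_var_rv2)
  have int: "integrable M (\<lambda>\<omega>. h (f \<omega>))" if [measurable]: "random_variable borel f" for f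
    using insert.prems(6) by (intro integrable_const_bound[of _ 1]) auto
  define \<phi> where "\<phi> x = expectation (\<lambda>\<omega>. h (x + S \<omega>))" for x
  interpret PX: prob_space "distr M borel (X i)" by (rule prob_space_distr) simp
  interpret PS: prob_space "distr M borel S" by (rule prob_space_distr) simp
  interpret P: pair_prob_space "distr M borel (X i)" "distr M borel S" ..
  have \<phi>: "\<phi> x = (\<integral>y. h (x + y) \<partial>distr M borel S)" for x
    unfolding \<phi>_def by (subst integral_distr) auto
  have [measurable]: "\<phi> \<in> borel_measurable borel"
    unfolding \<phi> by measurable
  \<comment> \<open>Independence makes the joint law a product, so Fubini applies.\<close>
  have joint: "expectation (\<lambda>\<omega>. h (X i \<omega> + S \<omega>)) = expectation (\<lambda>\<omega>. \<phi> (X i \<omega>))"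
  proof -
    have "expectation (\<lambda>\<omega>. h (X i \<omega> + S \<omega>))
        = (\<integral>z. h (fst z + snd z) \<partial>distr M (borel \<Otimes>\<^sub>M borel) (\<lambda>\<omega>. (X i \<omega>, S \<omega>)))"
      by (subst integral_distr) auto
    also have "distr M (borel \<Otimes>\<^sub>M borel) (\<lambda>\<omega>. (X i \<omega>, S \<omega>)) = distr M borel (X i) \<Otimes>\<^sub>M distr M borel S"
      using indep by (simp add: indep_var_distribution_eq)
    also have "(\<integral>z. h (fst z + snd z) \<partial>(distr M borel (X i) \<Otimes>\<^sub>M distr M borel S))
        = (\<integral>x. (\<integral>y. h (x + y) \<partial>distr M borel S) \<partial>distr M borel (X i))"
      using insert.prems(6)
      by (subst P.integral_fst'[symmetric]) (auto intro!: P.P.integrable_const_bound[of _ 1])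
    also have "\<dots> = expectation (\<lambda>\<omega>. \<phi> (X i \<omega>))"
      by (simp add: \<phi>[symmetric] integral_distr)
    finally show ?thesis .
  qed
  have IH: "m \<le> expectation (\<lambda>\<omega>. g (S \<omega>))"
    if "g \<in> borel_measurable borel" "\<And>s. \<bar>g s\<bar> \<le> 1" "\<And>xs. admissible 1 xs \<Longrightarrow> m \<le> two_point xs g" for g
    unfolding S_def using insert.prems(1-4) that
    by (intro insert.IH) (auto intro: indep_vars_subset)
  have "m \<le> \<phi> 0"
    unfolding \<phi>_def using IH[of h] insert.prems by simp
  moreover have "m \<le> (b * \<phi> (- a) + a * \<phi> b) / (a + b)" if ab: "0 < a" "a \<le> 1" "0 < b" for a b
  proof -
    \<comment> \<open>Averaging the two shifts of \<open>h\<close> amounts to prepending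
      \<open>(a, b)\<close> to the list, so \<open>?g\<close> inherits the lower bound
      \<open>m\<close>.\<close>
    let ?g = "\<lambda>s. b / (a + b) * h (s - a) + a / (a + b) * h (s + b)"
    have "m \<le> expectation (\<lambda>\<omega>. ?g (S \<omega>))"
    proof (rule IH)
      show "\<bar>?g s\<bar> \<le> 1" for s
      proof -
        have "\<bar>?g s\<bar> \<le> b / (a + b) * \<bar>h (s - a)\<bar> + a / (a + b) * \<bar>h (s + b)\<bar>"
          using ab by (auto intro!: order_trans[OF abs_triangle_ineq] simp: abs_mult)
        also have "\<dots> \<le> b / (a + b) * 1 + a / (a + b) * 1"
          using ab insert.prems(6) by (intro add_mono mult_left_mono) auto
        also have "\<dots> = 1" using ab by (simp add: add_divide_distrib[symmetric])
        finally show ?thesis .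
      qed
      show "m \<le> two_point xs ?g" if "admissible 1 xs" for xs
        using insert.prems(7)[of "(a, b) # xs"] that ab by (simp only: two_point_linear) (simp add: add_divide_distrib)
    qed measurable
    also have "\<dots> = (b * \<phi> (- a) + a * \<phi> b) / (a + b)"
      unfolding \<phi>_def by (simp add: int add_divide_distrib add.commute[of _ "S _"])
    finally show ?thesis .
  qed
  ultimately obtain l where l: "\<And>z. z \<ge> -1 \<Longrightarrow> m + l * z \<le> \<phi> z"
    using supporting_line by blast
  have bound: "\<bar>\<phi> x\<bar> \<le> 1" for x
    unfolding \<phi>_def abs_le_iff using insert.prems(6)
    by (auto intro!: integral_le_const integral_ge_const int simp: abs_le_iff minus_le_iff)
  have "m = expectation (\<lambda>\<omega>. m + l * X i \<omega>)"
    using insert.prems by (simp add: prob_space)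
  also have "\<dots> \<le> expectation (\<lambda>\<omega>. \<phi> (X i \<omega>))"
  proof (rule integral_mono_AE)
    show "AE \<omega> in M. m + l * X i \<omega> \<le> \<phi> (X i \<omega>)"
      using insert.prems(4)[of i] l by auto
    show "integrable M (\<lambda>\<omega>. \<phi> (X i \<omega>))"
      using bound by (intro integrable_const_bound[of _ 1]) auto
  qed (use insert.prems in auto)
  also have "\<dots> = expectation (\<lambda>\<omega>. h (\<Sum>i\<in>insert i I. X i \<omega>))"
    using insert.hyps by (simp add: joint S_def[symmetric] joint[unfolded S_def])
  finally show ?case .
qed

theorem theoremA1:
  fixes M :: "'a measure" and X :: "nat \<Rightarrow> 'a \<Rightarrow> real" and n :: nat
  assumes "prob_space M"
    and "n \<ge> 1"
    and "prob_space.indep_vars M (\<lambda>_. borel) X {1..n}"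
    and "\<And>i. i \<in> {1..n} \<Longrightarrow> integrable M (X i)"
    and "\<And>i. i \<in> {1..n} \<Longrightarrow> prob_space.expectation M (X i) = 0"
    and "\<And>i. i \<in> {1..n} \<Longrightarrow> (AE \<omega> in M. X i \<omega> \<ge> -1)"
  shows "\<P>(\<omega> in M. (\<Sum>i=1..n. X i \<omega>) \<le> 1) \<ge> 0.1536"
proof -
  interpret prob_space M by fact
  let ?S = "\<lambda>\<omega>. \<Sum>i=1..n. X i \<omega>"
  have "5/32 \<le> expectation (\<lambda>\<omega>. indicator {..1} (?S \<omega>) :: real)"
    by (rule expectation_ge_of_two_point[OF _ assms(3-6) _ _ two_point_ge]) simp_all
  also have "\<dots> = expectation (indicator {\<omega> \<in> space M. ?S \<omega> \<le> 1})"
    by (intro Bochner_Integration.integral_cong) (auto simp: indicator_def)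
  also have "\<dots> = \<P>(\<omega> in M. ?S \<omega> \<le> 1)" by (simp add: Int_absorb2 subset_iff)
  finally show ?thesis by simp
qed

end
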